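(* Let $f_{0}\in\Gamma$ be such that $\mathcal{L}(f_{0})$ is bounded, let $x_{0}\in\mathcal{L}(f_{0})$, let $\alpha_{0}>0$ and $E_{0}:=\mathcal{L}(f_{0})+\alpha_{0}\mathbb{B}$. Let $$U_{0}:=\{(a,b)\in\mathbb{R}^{n}\times\mathbb{R}:b=a^{\prime}z-f_{0}(z),\ a\in\partial f_{0}(z),\ z\in E_{0}\},\qquad C_{U_{0}}:=\{u\in\mathbb{R}^{n}:(u,u^{\prime}x_{0})\in\mathrm{cl}\,\mathrm{conv}\,U_{0}\},$$ $$\kappa_{0}:=\frac{\|x_{0}\|+1}{d(0_{n},C_{U_{0}})}.$$ Let $\kappa>\kappa_{0}$ (a real number), $\alpha>0$, $E:=E_{0}+\alpha\mathbb{B}$, and $\rho:=\max\{1+\|x\|:x\in E\}$. Then there exists $\delta_{0}>0$ such that $0<\delta\le\delta_{0}$ implies $$d(x_{1},\mathcal{L}(f_{2}))\le\kappa\left(\rho\, d_{H}\!\left(\partial f_{1}(E_{0}+\sqrt{\delta}\,\mathbb{B}),\ \partial f_{2}(E_{0}+\sqrt{\delta}\,\mathbb{B})\right)+d_{E}(f_{1},f_{2})\right)$$ whenever $f_{1},f_{2}\in\Gamma$, $x_{1}\in\mathcal{L}(f_{1})$, $d_{E}(f_{i},f_{0})\le\delta$ for $i=1,2$, and $\|x_{1}-x_{0}\|\le\delta$.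
   Context: $\mathbb{R}^{n}$ carries the Euclidean norm $\|\cdot\|$, $\mathbb{B}$ is its closed unit ball, and $a^{\prime}x$ is the usual inner product. $\Gamma$ is the set of all finite-valued convex functions $f:\mathbb{R}^{n}\to\mathbb{R}$, and $\mathcal{L}(f):=\{x\in\mathbb{R}^{n}:f(x)\le 0\}$. $\partial f(z)=\{a\in\mathbb{R}^{n}: f(x)\ge f(z)+a^{\prime}(x-z)\ \text{for all }x\in\mathbb{R}^{n}\}$ is the subdifferential, and $\partial f(S)=\bigcup_{z\in S}\partial f(z)$. For a compact set $K$, $d_{K}(f_{1},f_{2}):=\sup_{x\in K}|f_{1}(x)-f_{2}(x)|$. For nonempty sets $A,B$, $d_{H}(A,B)=\max\{\sup_{x\in A}d(x,B),\sup_{y\in B}d(y,A)\}$ is the Hausdorff distance, with $d(x,B)=\inf_{y\in B}\|x-y\|$; the distance from a point to the empty set is $+\infty$. $\mathrm{cl}\,\mathrm{conv}$ denotes the closed convex hull. For a positive number $c$ the conventions $c/0=+\infty$ and $c/(+\infty)=0$ are used in the definition of $\kappa_{0}$. *)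

theory Defs
  imports "HOL-Analysis.Analysis" "HOL-Library.Set_Algebras"
begin

definition Gam :: "('a::real_vector \<Rightarrow> real) set" where
  "Gam = {f. convex_on UNIV f}"

definition levelset :: "('a \<Rightarrow> real) \<Rightarrow> 'a set" where
  "levelset f = {x. f x \<le> 0}"

definition subdiff :: "('a::real_inner \<Rightarrow> real) \<Rightarrow> 'a \<Rightarrow> 'a set" where
  "subdiff f z = {a. \<forall>x. f x \<ge> f z + a \<bullet> (x - z)}"

definition subdiff_on :: "('a::real_inner \<Rightarrow> real) \<Rightarrow> 'a set \<Rightarrow> 'a set" where
  "subdiff_on f S = (\<Union>z\<in>S. subdiff f z)"

(* Distances are extended reals. The library's infdist is real-valued and sends the
   empty set to 0; here the distance from a point to the empty set is \<infinity>. *)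
definition edist_pt :: "'a::real_normed_vector \<Rightarrow> 'a set \<Rightarrow> ereal" where
  "edist_pt x B = (INF y\<in>B. ereal (norm (x - y)))"

(* Only meaningful for nonempty A and B: a supremum over the empty set is -\<infinity>. *)
definition ehausdorff :: "'a::real_normed_vector set \<Rightarrow> 'a set \<Rightarrow> ereal" where
  "ehausdorff A B = max (SUP x\<in>A. edist_pt x B) (SUP y\<in>B. edist_pt y A)"

definition esupdist :: "'a set \<Rightarrow> ('a \<Rightarrow> real) \<Rightarrow> ('a \<Rightarrow> real) \<Rightarrow> ereal" where
  "esupdist K f1 f2 = (SUP x\<in>K. ereal \<bar>f1 x - f2 x\<bar>)"

definition Uset :: "('a::real_inner \<Rightarrow> real) \<Rightarrow> 'a set \<Rightarrow> ('a \<times> real) set" where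
  "Uset f S = {(a, b). \<exists>z\<in>S. a \<in> subdiff f z \<and> b = a \<bullet> z - f z}"

definition Cset :: "('a::real_inner \<times> real) set \<Rightarrow> 'a \<Rightarrow> 'a set" where
  "Cset U x = {u. (u, u \<bullet> x) \<in> closure (convex hull U)}"

(* Division of extended reals: c / 0 = \<infinity> and c / \<infinity> = 0 for real c > 0. *)
definition kappa0 :: "('a::real_inner \<times> real) set \<Rightarrow> 'a \<Rightarrow> ereal" where
  "kappa0 U x = ereal (norm x + 1) / edist_pt 0 (Cset U x)"

definition rho_of :: "'a::real_normed_vector set \<Rightarrow> real" where
  "rho_of E = (SUP x\<in>E. 1 + norm x)"

(* For the compact sets of interest the supremum in rho_of is a maximum. *)
lemma rho_of_is_max:
  assumes "compact E" "E \<noteq> {}"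
  shows "rho_of E \<in> (\<lambda>x. 1 + norm x) ` E" "\<And>x. x \<in> E \<Longrightarrow> 1 + norm x \<le> rho_of E"
proof -
  have "continuous_on E (\<lambda>x. 1 + norm x)"
    by (intro continuous_intros)
  then obtain m where m: "m \<in> E" "\<forall>y\<in>E. 1 + norm y \<le> 1 + norm m"
    using continuous_attains_sup assms by blast
  then have "rho_of E = 1 + norm m"
    unfolding rho_of_def by (intro cSup_eq_maximum) auto
  with m show "rho_of E \<in> (\<lambda>x. 1 + norm x) ` E" "\<And>x. x \<in> E \<Longrightarrow> 1 + norm x \<le> rho_of E"
    by auto
qed

lemma kappa0_conventions:
  assumes "c > 0"
  shows "ereal c / 0 = \<infinity>" "ereal c / \<infinity> = 0" "edist_pt x {} = \<infinity>"
  using assms by (auto simp: divide_ereal_def edist_pt_def top_ereal_def)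

end

theory Submission
  imports Defs
begin

text \<open>
  The estimate is a local error bound for \<open>f2\<close> that is uniform in \<open>f2\<close>. As \<open>f1 x1 \<le> 0\<close>, the
  residual \<open>f2 x1\<close> is at most \<open>f2 x1 - f1 x1\<close>, hence at most the uniform distance of \<open>f1\<close> and
  \<open>f2\<close> on \<open>E\<close>; and \<open>\<rho>\<close> times the Hausdorff distance is nonnegative, since subdifferentials of
  finite convex functions are nonempty. So it is enough to bound the distance from \<open>x1\<close> to the
  level set of \<open>f2\<close> by \<open>\<kappa>\<close> times the positive part of \<open>f2 x1\<close>.

  This bound comes from exact penalization. Let \<open>y\<close> minimize
  \<open>\<kappa> * max (f2 y) 0 + norm (y - x1)\<close>. If \<open>f2 y \<le> 0\<close>, comparison with the value at \<open>x1\<close> is the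
  bound. If \<open>f2 y > 0\<close>, a sandwich argument turns minimality into a subgradient of \<open>f2\<close> at \<open>y\<close>
  of norm at most \<open>1 / \<kappa>\<close> (\<open>penalty_alternative\<close>).

  The second case is impossible for small \<open>\<delta>\<close>. Otherwise there would be functions tending to
  \<open>f0\<close> on \<open>E\<close>, points \<open>y\<close> tending to \<open>x0\<close> at which these functions are positive, and subgradients
  there of norm at most \<open>1 / \<kappa>\<close>. In the limit \<open>f0 x0 = 0\<close>, and \<open>f0\<close> has a subgradient \<open>a\<close> at
  \<open>x0\<close> of norm at most \<open>1 / \<kappa>\<close> (\<open>uniform_error_bound\<close>). Then \<open>(a, a \<bullet> x0)\<close> is in \<open>Uset f0 E0\<close>,
  so \<open>a\<close> is in \<open>Cset (Uset f0 E0) x0\<close>, and the quotient that defines \<open>kappa0\<close> is at least \<open>\<kappa>\<close>,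
  contrary to the choice of \<open>\<kappa>\<close>.
\<close>

section \<open>Subgradients of finite convex functions\<close>

text \<open>
  The strict epigraph of \<open>f\<close> and the hypograph of \<open>g\<close> over \<open>T\<close> are disjoint convex sets, and a
  hyperplane separating them is not vertical, because \<open>f\<close> is finite on the whole space. For
  \<open>T = {z}\<close> the affine function obtained is a supporting one at \<open>z\<close>; for \<open>g\<close> a downward cone with
  apex at \<open>z\<close> its slope is bounded in addition.
\<close>
lemma convex_concave_sandwich:
  fixes f g :: "'a::euclidean_space \<Rightarrow> real"
  assumes f: "convex_on UNIV f" and g: "concave_on T g" and T: "T \<noteq> {}"
    and le: "\<And>x. x \<in> T \<Longrightarrow> g x \<le> f x"
  obtains a b where "\<And>x. a \<bullet> x + b \<le> f x" "\<And>x. x \<in> T \<Longrightarrow> g x \<le> a \<bullet> x + b"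
proof -
  define S where "S = {(x, r). f x < r}"
  define H where "H = {(x, r). x \<in> T \<and> r \<le> g x}"
  have "convex S"
    unfolding convex_def S_def
  proof (clarsimp)
    fix x y :: 'a and r s u v :: real
    assume h: "f x < r" "f y < s" "0 \<le> u" "0 \<le> v" "u + v = 1"
    have "f (u *\<^sub>R x + v *\<^sub>R y) \<le> u * f x + v * f y"
      using f h unfolding convex_on_def by auto
    moreover have "u * f x + v * f y < u * r + v * s"
    proof (cases "u = 0")
      case False
      then have "u * f x < u * r" using h by auto
      moreover have "v * f y \<le> v * s" using h by (intro mult_left_mono) auto
      ultimately show ?thesis by simp
    qed (use h in auto)
    ultimately show "f (u *\<^sub>R x + v *\<^sub>R y) < u * r + v * s" by linarith
  qed
  moreover have "convex H"
    unfolding convex_def H_def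
  proof (clarsimp)
    fix x y :: 'a and r s u v :: real
    assume h: "x \<in> T" "y \<in> T" "r \<le> g x" "s \<le> g y" "0 \<le> u" "0 \<le> v" "u + v = 1"
    have "u * g x + v * g y \<le> g (u *\<^sub>R x + v *\<^sub>R y)" "u *\<^sub>R x + v *\<^sub>R y \<in> T"
      using g h unfolding concave_on_iff convex_def by auto
    moreover have "u * r + v * s \<le> u * g x + v * g y"
      using h by (intro add_mono mult_left_mono) auto
    ultimately show "u *\<^sub>R x + v *\<^sub>R y \<in> T \<and> u * r + v * s \<le> g (u *\<^sub>R x + v *\<^sub>R y)"
      by linarith
  qed
  moreover have "S \<inter> H = {}"
    using le by (force simp: S_def H_def)
  moreover have "(0, f 0 + 1) \<in> S" by (simp add: S_def)
  moreover obtain z where z: "z \<in> T" using T by blast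
  then have "(z, g z) \<in> H" by (simp add: H_def)
  ultimately obtain p c where p: "p \<noteq> 0" "\<forall>w\<in>S. p \<bullet> w \<le> c" "\<forall>w\<in>H. c \<le> p \<bullet> w"
    using separating_hyperplane_sets[of S H] by (metis empty_iff)
  obtain q t where qt: "p = (q, t)" by force
  have up: "q \<bullet> x + t * r \<le> c" if "f x < r" for x r
    using p(2) that unfolding S_def qt by force
  have lo: "c \<le> q \<bullet> x + t * g x" if "x \<in> T" for x
    using p(3) that unfolding H_def qt by force
  have "t < 0"
  proof (rule ccontr)
    assume "\<not> t < 0"
    moreover have False if "t > 0"
    proof -
      have "q \<bullet> z + t * (f z + 1) \<le> c" by (rule up) simp
      moreover have "t * (f z + 1) > t * g z"
        using that le[OF z] by (intro mult_strict_left_mono) auto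
      ultimately show False using lo[OF z] by linarith
    qed
    moreover have False if "t = 0"
    proof -
      \<comment> \<open>A vertical hyperplane through \<open>z\<close> is crossed in the direction \<open>q\<close>.\<close>
      have "q \<bullet> (z + q) \<le> c" using up[of "z + q" "f (z + q) + 1"] that by simp
      moreover have "c \<le> q \<bullet> z" using lo[OF z] that by simp
      ultimately have "q \<bullet> q \<le> 0" by (simp add: inner_add_right)
      then have "q = 0" by (metis inner_ge_zero antisym inner_eq_zero_iff)
      then show False using p(1) qt that by (simp add: zero_prod_def)
    qed
    ultimately show False by linarith
  qed
  \<comment> \<open>The separation gives strict epigraph values only; \<open>f x\<close> itself is reached as a limit.\<close>
  have up': "q \<bullet> x + t * f x \<le> c" for x
  proof (rule field_le_epsilon)
    fix e :: real assume "e > 0"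
    then have "q \<bullet> x + t * (f x + e / (- t)) \<le> c"
      using \<open>t < 0\<close> by (intro up) (auto simp: divide_pos_neg)
    then show "q \<bullet> x + t * f x \<le> c + e"
      using \<open>t < 0\<close> by (simp add: algebra_simps)
  qed
  show thesis
  proof
    show "((- 1 / t) *\<^sub>R q) \<bullet> x + c / t \<le> f x" for x
      using up'[of x] \<open>t < 0\<close> by (simp add: field_simps)
    show "g x \<le> ((- 1 / t) *\<^sub>R q) \<bullet> x + c / t" if "x \<in> T" for x
      using lo[OF that] \<open>t < 0\<close> by (simp add: field_simps)
  qed
qed

lemma subdiff_nonempty:
  fixes f :: "'a::euclidean_space \<Rightarrow> real"
  assumes "convex_on UNIV f"
  shows "subdiff f z \<noteq> {}"
proof -
  have "concave_on {z} f"
    by (auto simp: concave_on_iff simp flip: scaleR_add_left distrib_right)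
  then obtain a b where ab: "\<And>x. a \<bullet> x + b \<le> f x" "\<And>x. x \<in> {z} \<Longrightarrow> f x \<le> a \<bullet> x + b"
    using convex_concave_sandwich[OF assms, of "{z}" f] by auto
  have "f z + a \<bullet> (x - z) \<le> f x" for x
    using ab(1)[of x] ab(2)[of z] by (simp add: inner_diff_right)
  then show ?thesis unfolding subdiff_def by blast
qed

text \<open>
  Subtracting the linear part turns the subgradient inequality into minimality at \<open>y\<close>, and a
  local minimum of a convex function is global.
\<close>
lemma local_subgradient:
  fixes f :: "'a::euclidean_space \<Rightarrow> real"
  assumes f: "convex_on UNIV f"
    and ev: "eventually (\<lambda>x. f y + a \<bullet> (x - y) \<le> f x) (nhds y)"
  shows "a \<in> subdiff f y"
proof -
  obtain e where e: "e > 0" "\<And>x. dist x y < e \<Longrightarrow> f y + a \<bullet> (x - y) \<le> f x"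
    using ev unfolding eventually_nhds_metric by auto
  have "convex_on UNIV (\<lambda>x. f x + (- a) \<bullet> x)"
    using f by (intro convex_on_add) (auto simp: convex_on_def algebra_simps)
  then have "f y + (- a) \<bullet> y \<le> f x + (- a) \<bullet> x" for x
    using e convex_local_global_minimum[of e UNIV "\<lambda>x. f x + (- a) \<bullet> x" y]
    by (fastforce simp: inner_diff_right dist_commute)
  then show ?thesis
    unfolding subdiff_def by (simp add: inner_diff_right) (smt (verit))
qed

text \<open>
  Only convergence near the limit point is known, so the inequality passes to the limit near
  \<open>x\<close>, and convexity of \<open>f\<close> extends it to the whole space.
\<close>
lemma subdiff_limit:
  fixes f :: "'a::euclidean_space \<Rightarrow> real"
  assumes f: "convex_on UNIV f" and x: "x \<in> interior E"
    and F: "\<And>w. w \<in> E \<Longrightarrow> (\<lambda>k. F k w) \<longlonglongrightarrow> f w"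
    and y: "y \<longlonglongrightarrow> x" and Fy: "(\<lambda>k. F k (y k)) \<longlonglongrightarrow> f x"
    and a: "a \<longlonglongrightarrow> l" and sub: "\<And>k. a k \<in> subdiff (F k) (y k)"
  shows "l \<in> subdiff f x"
proof (rule local_subgradient[OF f])
  have "f x + l \<bullet> (w - x) \<le> f w" if "w \<in> E" for w
  proof (rule LIMSEQ_le[OF _ F[OF that]])
    show "(\<lambda>k. F k (y k) + a k \<bullet> (w - y k)) \<longlonglongrightarrow> f x + l \<bullet> (w - x)"
      by (intro tendsto_intros Fy a y)
    show "\<exists>N. \<forall>k\<ge>N. F k (y k) + a k \<bullet> (w - y k) \<le> F k w"
      using sub unfolding subdiff_def by blast
  qed
  moreover have "eventually (\<lambda>w. w \<in> interior E) (nhds x)"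
    using x by (intro eventually_nhds_in_open) auto
  ultimately show "eventually (\<lambda>w. f x + l \<bullet> (w - x) \<le> f w) (nhds x)"
    by (auto elim!: eventually_mono simp: interior_subset[THEN subsetD])
qed

section \<open>The error bound by exact penalization\<close>

text \<open>
  The point \<open>y\<close> minimizes \<open>\<kappa> * max (f y) 0 + norm (y - x)\<close>. Minimality says that the positive
  part of \<open>f\<close> lies above the cone of slope \<open>1 / \<kappa>\<close> pointing down from its value at \<open>y\<close>; an affine
  function between the two has a gradient of norm at most \<open>1 / \<kappa>\<close>, and it is a subgradient of
  \<open>f\<close> if \<open>f y > 0\<close>, because then \<open>f\<close> is its own positive part near \<open>y\<close>.
\<close>
lemma penalty_alternative:
  fixes f :: "'a::euclidean_space \<Rightarrow> real"
  assumes f: "convex_on UNIV f" and \<kappa>: "\<kappa> > 0" and pos: "f x > 0"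
  obtains (feasible) y where "f y \<le> 0" "norm (y - x) \<le> \<kappa> * f x"
  | (small_subgradient) y a where "f y > 0" "norm (y - x) \<le> \<kappa> * f x"
      "a \<in> subdiff f y" "\<kappa> * norm a \<le> 1"
proof -
  define g where "g = (\<lambda>y. max (f y) 0)"
  have "convex_on UNIV g"
    unfolding convex_on_def
  proof (clarsimp)
    fix v w :: 'a and s t :: real
    assume st: "0 \<le> s" "0 \<le> t" "s + t = 1"
    have "f (s *\<^sub>R v + t *\<^sub>R w) \<le> s * f v + t * f w"
      using f st unfolding convex_on_def by auto
    also have "\<dots> \<le> s * g v + t * g w"
      using st by (intro add_mono mult_left_mono) (auto simp: g_def)
    finally show "g (s *\<^sub>R v + t *\<^sub>R w) \<le> s * g v + t * g w"
      using st by (simp add: g_def)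
  qed
  have cont: "continuous_on UNIV f"
    using f by (intro convex_on_continuous) auto
  have "continuous_on (cball x (\<kappa> * f x)) (\<lambda>y. \<kappa> * g y + norm (y - x))"
    unfolding g_def by (intro continuous_intros continuous_on_subset[OF cont]) auto
  moreover have "x \<in> cball x (\<kappa> * f x)" using \<kappa> pos by simp
  ultimately obtain y where y: "y \<in> cball x (\<kappa> * f x)"
    and min: "\<And>w. w \<in> cball x (\<kappa> * f x) \<Longrightarrow> \<kappa> * g y + norm (y - x) \<le> \<kappa> * g w + norm (w - x)"
    using continuous_attains_inf[of "cball x (\<kappa> * f x)" "\<lambda>y. \<kappa> * g y + norm (y - x)"]
    by (metis compact_cball empty_iff)
  have ny: "norm (y - x) \<le> \<kappa> * f x"
    using y by (simp add: dist_norm norm_minus_commute)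
  have glob: "\<kappa> * g y + norm (y - x) \<le> \<kappa> * g w + norm (w - x)" for w
  proof (cases "w \<in> cball x (\<kappa> * f x)")
    case False
    \<comment> \<open>Outside the ball the norm alone exceeds the value at the centre.\<close>
    then have "\<kappa> * g x + norm (x - x) \<le> norm (w - x)"
      using pos by (simp add: g_def dist_norm norm_minus_commute)
    moreover have "0 \<le> \<kappa> * g w" using \<kappa> by (simp add: g_def)
    ultimately show ?thesis using min[of x] \<kappa> pos by simp
  qed (use min in auto)
  show thesis
  proof (cases "f y > 0")
    case False
    then show thesis using ny by (intro feasible[of y]) auto
  next
    case True
    define cone where "cone = (\<lambda>w. g y - norm (w - y) / \<kappa>)"
    have "concave_on UNIV cone"
    proof -
      have "convex_on UNIV (\<lambda>w. norm (w - y) / \<kappa> + - g y)"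
      proof (intro convex_on_add convex_on_cdiv)
        show "convex_on UNIV (\<lambda>w. norm (w - y))"
          using convex_on_dist[of UNIV y] by (simp add: dist_norm norm_minus_commute)
      qed (use \<kappa> in \<open>auto simp: convex_on_const\<close>)
      then show ?thesis by (simp add: concave_on_def cone_def)
    qed
    moreover have "cone w \<le> g w" for w
    proof -
      have "norm (w - x) \<le> norm (w - y) + norm (y - x)"
        using norm_triangle_ineq[of "w - y" "y - x"] by simp
      then have "\<kappa> * g y \<le> \<kappa> * g w + norm (w - y)" using glob[of w] by linarith
      then show ?thesis using \<kappa> by (simp add: cone_def field_simps)
    qed
    ultimately obtain a b where ab: "\<And>w. a \<bullet> w + b \<le> g w" "\<And>w. cone w \<le> a \<bullet> w + b"
      using convex_concave_sandwich[OF \<open>convex_on UNIV g\<close>, of UNIV cone] by auto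
    have aff: "a \<bullet> y + b = g y"
      using ab(1)[of y] ab(2)[of y] by (simp add: cone_def)
    have "\<kappa> * norm a \<le> 1"
    proof (cases "a = 0")
      case False
      have "g y - norm a / \<kappa> \<le> g y - norm a * norm a"
        using ab(2)[of "y - a"] aff
        by (simp add: cone_def inner_diff_right dot_square_norm power2_eq_square)
      then have "norm a * (\<kappa> * norm a) \<le> norm a * 1" using \<kappa> by (simp add: field_simps)
      then show ?thesis using False by simp
    qed simp
    moreover have "a \<in> subdiff f y"
    proof (rule local_subgradient[OF f])
      have "isCont f y"
        using cont by (simp add: continuous_on_eq_continuous_at)
      then have "eventually (\<lambda>w. f w > 0) (nhds y)"
        using True by (intro order_tendstoD(1)) (auto simp: continuous_at tendsto_at_iff_tendsto_nhds)
      then show "eventually (\<lambda>w. f y + a \<bullet> (w - y) \<le> f w) (nhds y)"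
      proof (rule eventually_mono)
        fix w assume "f w > 0"
        then show "f y + a \<bullet> (w - y) \<le> f w"
          using ab(1)[of w] aff True by (simp add: g_def inner_diff_right)
      qed
    qed
    ultimately show thesis using True ny by (intro small_subgradient[of y a]) auto
  qed
qed

text \<open>
  By compactness: if the bound failed for arbitrarily small \<open>\<delta>\<close>, the second alternative of
  \<open>penalty_alternative\<close> would supply subgradients in the ball of radius \<open>1 / \<kappa>\<close> at points tending
  to \<open>x0\<close>, and a limit of a subsequence of them would contradict \<open>large\<close>. Positivity at these
  points gives \<open>f0 x0 \<ge> 0\<close> in the limit, so that \<open>large\<close> covers the case \<open>f0 x0 = 0\<close> only. The
  bound on \<open>f x\<close> makes these points, which are within \<open>\<kappa> * f x\<close> of \<open>x\<close>, tend to \<open>x0\<close>.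
\<close>
lemma uniform_error_bound:
  fixes f0 :: "'a::euclidean_space \<Rightarrow> real"
  assumes f0: "convex_on UNIV f0" and x0: "f0 x0 \<le> 0" "x0 \<in> interior E" and \<kappa>: "\<kappa> > 0"
    and large: "\<And>a. f0 x0 = 0 \<Longrightarrow> a \<in> subdiff f0 x0 \<Longrightarrow> \<kappa> * norm a > 1"
  obtains \<delta>0 where "\<delta>0 > 0"
    "\<And>\<delta> f x. \<lbrakk>\<delta> \<le> \<delta>0; convex_on UNIV f; \<And>w. w \<in> E \<Longrightarrow> \<bar>f w - f0 w\<bar> \<le> \<delta>;
        norm (x - x0) \<le> \<delta>; 0 < f x; f x \<le> 2 * \<delta>\<rbrakk>
      \<Longrightarrow> \<exists>y. f y \<le> 0 \<and> norm (y - x) \<le> \<kappa> * f x"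
proof -
  define bad where "bad = (\<lambda>\<delta> f y a.
      (\<forall>w\<in>E. \<bar>f w - f0 w\<bar> \<le> \<delta>) \<and> norm (y - x0) \<le> (1 + 2 * \<kappa>) * \<delta> \<and> f y > 0 \<and>
      a \<in> subdiff f y \<and> \<kappa> * norm (a::'a) \<le> 1)"
  show thesis
  proof (cases "\<exists>\<delta>0>0. \<forall>\<delta> f y a. \<delta> \<le> \<delta>0 \<longrightarrow> \<not> bad \<delta> f y a")
    case True
    then obtain \<delta>0 where \<delta>0: "\<delta>0 > 0" "\<And>\<delta> f y a. \<delta> \<le> \<delta>0 \<Longrightarrow> \<not> bad \<delta> f y a" by blast
    show thesis
    proof (rule that[OF \<delta>0(1)])
      fix \<delta> f and x :: 'a
      assume h: "\<delta> \<le> \<delta>0" "convex_on UNIV f" "\<And>w. w \<in> E \<Longrightarrow> \<bar>f w - f0 w\<bar> \<le> \<delta>"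
        "norm (x - x0) \<le> \<delta>" "0 < f x" "f x \<le> 2 * \<delta>"
      from h(2) \<kappa> h(5) show "\<exists>y. f y \<le> 0 \<and> norm (y - x) \<le> \<kappa> * f x"
      proof (cases rule: penalty_alternative)
        case (small_subgradient y a)
        have "\<kappa> * f x \<le> \<kappa> * (2 * \<delta>)" using h(6) \<kappa> by (intro mult_left_mono) auto
        moreover have "norm (y - x0) \<le> norm (y - x) + norm (x - x0)"
          using norm_triangle_ineq[of "y - x" "x - x0"] by simp
        ultimately have "norm (y - x0) \<le> (1 + 2 * \<kappa>) * \<delta>"
          using small_subgradient(2) h(4) by (simp add: algebra_simps)
        then have "bad \<delta> f y a" using small_subgradient h(3) by (auto simp: bad_def)
        then show ?thesis using \<delta>0(2)[OF h(1)] by blast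
      qed auto
    qed
  next
    case False
    then have "\<forall>k. \<exists>\<delta> f y a. \<delta> \<le> 1 / real (Suc k) \<and> bad \<delta> f y a"
      by (metis of_nat_0_less_iff zero_less_Suc zero_less_divide_1_iff)
    then obtain d F y a where d: "\<And>k. d k \<le> 1 / real (Suc k)"
      and bad: "\<And>k. bad (d k) (F k) (y k) (a k)" by metis
    have near: "\<bar>F k w - f0 w\<bar> \<le> d k" if "w \<in> E" for k w
      using bad that unfolding bad_def by blast
    have d_lim: "d \<longlonglongrightarrow> 0"
    proof (rule tendsto_sandwich[OF _ _ tendsto_const LIMSEQ_inverse_real_of_nat])
      have "x0 \<in> E" using x0(2) interior_subset by blast
      from order_trans[OF abs_ge_zero near[OF this]]
      show "\<forall>\<^sub>F k in sequentially. 0 \<le> d k" by simp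
      show "\<forall>\<^sub>F k in sequentially. d k \<le> inverse (real (Suc k))"
        using d by (simp add: inverse_eq_divide)
    qed
    have y_lim: "y \<longlonglongrightarrow> x0"
    proof (rule LIM_zero_cancel, rule Lim_null_comparison)
      show "\<forall>\<^sub>F k in sequentially. norm (y k - x0) \<le> (1 + 2 * \<kappa>) * d k"
        using bad unfolding bad_def by simp
      show "(\<lambda>k. (1 + 2 * \<kappa>) * d k) \<longlonglongrightarrow> 0"
        using tendsto_mult_right_zero[OF d_lim] by simp
    qed
    have "isCont f0 x0"
      using convex_on_continuous[OF open_UNIV f0] by (simp add: continuous_on_eq_continuous_at)
    then have f0y: "(\<lambda>k. f0 (y k)) \<longlonglongrightarrow> f0 x0"
      using y_lim by (rule isCont_tendsto_compose)
    have "eventually (\<lambda>k. y k \<in> interior E) sequentially"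
      using topological_tendstoD[OF y_lim _ x0(2)] by simp
    then have "\<forall>\<^sub>F k in sequentially. norm (F k (y k) - f0 (y k)) \<le> d k"
      by (rule eventually_mono) (use near interior_subset in force)
    from Lim_null_comparison[OF this d_lim] have Fy: "(\<lambda>k. F k (y k)) \<longlonglongrightarrow> f0 x0"
      using tendsto_add[OF _ f0y] by fastforce
    have "0 \<le> f0 x0"
      by (rule LIMSEQ_le_const[OF Fy]) (use bad in \<open>auto simp: bad_def intro: less_imp_le\<close>)
    then have zero: "f0 x0 = 0" using x0(1) by simp
    have "a k \<in> cball 0 (1 / \<kappa>)" for k
      using bad[of k] \<kappa> by (simp add: bad_def field_simps)
    then obtain l r where l: "l \<in> cball 0 (1 / \<kappa>)" and r: "strict_mono r" "(a \<circ> r) \<longlonglongrightarrow> l"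
      using compact_cball[of 0 "1 / \<kappa>"] unfolding compact_def by meson
    have "l \<in> subdiff f0 x0"
    proof (rule subdiff_limit[OF f0 x0(2)])
      show "(\<lambda>k. (F \<circ> r) k w) \<longlonglongrightarrow> f0 w" if "w \<in> E" for w
      proof -
        have "(\<lambda>k. F k w - f0 w) \<longlonglongrightarrow> 0"
          by (rule Lim_null_comparison[OF _ d_lim]) (use near[OF that] in auto)
        then have "(\<lambda>k. F k w) \<longlonglongrightarrow> f0 w" by (rule LIM_zero_cancel)
        from LIMSEQ_subseq_LIMSEQ[OF this r(1)] show ?thesis by (simp add: o_def)
      qed
      show "(y \<circ> r) \<longlonglongrightarrow> x0" by (rule LIMSEQ_subseq_LIMSEQ[OF y_lim r(1)])
      show "(\<lambda>k. (F \<circ> r) k ((y \<circ> r) k)) \<longlonglongrightarrow> f0 x0"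
        using LIMSEQ_subseq_LIMSEQ[OF Fy r(1)] by (simp add: o_def)
      show "(a \<circ> r) k \<in> subdiff ((F \<circ> r) k) ((y \<circ> r) k)" for k
        using bad[of "r k"] by (simp add: bad_def)
    qed (rule r(2))
    from large[OF zero this] l \<kappa> show thesis by (simp add: field_simps)
  qed
qed

section \<open>Distances and the constant of the estimate\<close>

lemma ehausdorff_nonneg:
  assumes "A \<noteq> {}"
  shows "0 \<le> ehausdorff A B"
proof -
  obtain x where x: "x \<in> A" using assms by blast
  have "0 \<le> edist_pt x B" unfolding edist_pt_def by (auto intro: INF_greatest)
  also have "\<dots> \<le> (SUP x\<in>A. edist_pt x B)" by (rule SUP_upper[OF x])
  also have "\<dots> \<le> ehausdorff A B" by (simp add: ehausdorff_def)
  finally show ?thesis .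
qed

lemma abs_le_esupdist: "x \<in> K \<Longrightarrow> ereal \<bar>f x - g x\<bar> \<le> esupdist K f g"
  unfolding esupdist_def by (rule SUP_upper)

lemma kappa0_nonneg: "0 \<le> kappa0 U x"
proof -
  have "0 \<le> edist_pt 0 (Cset U x)" unfolding edist_pt_def by (auto intro: INF_greatest)
  then show ?thesis
    unfolding kappa0_def by (cases "edist_pt 0 (Cset U x)") (auto simp: divide_ereal_def)
qed

text \<open>
  If \<open>f x = 0\<close>, a subgradient \<open>a\<close> of \<open>f\<close> at \<open>x\<close> gives the pair \<open>(a, a \<bullet> x)\<close> in \<open>Uset\<close>, so \<open>a\<close>
  itself is in \<open>Cset\<close> and its norm bounds the distance \<open>d\<close> of \<open>Cset\<close> to the origin from above.
  Then \<open>\<kappa>\<close> exceeds \<open>(norm x + 1) / d\<close>, which is at least \<open>1 / norm a\<close>.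
\<close>
lemma subgradient_norm_gt:
  assumes "f x = 0" "x \<in> S" "a \<in> subdiff f x" and \<kappa>: "kappa0 (Uset f S) x < ereal \<kappa>"
  shows "1 < \<kappa> * norm a"
proof (rule ccontr)
  assume n: "\<not> 1 < \<kappa> * norm a"
  have "0 < ereal \<kappa>" by (rule le_less_trans[OF kappa0_nonneg \<kappa>])
  then have pos: "\<kappa> > 0" by simp
  have "(a, a \<bullet> x) \<in> Uset f S" using assms by (auto simp: Uset_def)
  then have "a \<in> Cset (Uset f S) x"
    by (auto simp: Cset_def intro!: closure_subset[THEN subsetD] hull_inc)
  then have "edist_pt 0 (Cset (Uset f S) x) \<le> ereal (norm (0 - a))"
    unfolding edist_pt_def by (rule INF_lower)
  then have le: "edist_pt 0 (Cset (Uset f S) x) \<le> ereal (norm a)" by simp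
  have ge: "0 \<le> edist_pt 0 (Cset (Uset f S) x)"
    unfolding edist_pt_def by (auto intro: INF_greatest)
  obtain d where d: "edist_pt 0 (Cset (Uset f S) x) = ereal d" "0 \<le> d" "d \<le> norm a"
    using le ge by (cases "edist_pt 0 (Cset (Uset f S) x)") auto
  have c: "norm x + 1 > 0" by (simp add: add_nonneg_pos)
  have q: "ereal (norm x + 1) / ereal d < ereal \<kappa>"
    using \<kappa> unfolding kappa0_def d(1) .
  have "d \<noteq> 0"
  proof
    assume "d = 0"
    then have "ereal (norm x + 1) / ereal d = \<infinity>"
      using kappa0_conventions(1)[OF c] by (simp add: zero_ereal_def)
    with q show False by simp
  qed
  then have "(norm x + 1) / d < \<kappa>" using q by simp
  then have "norm x + 1 < \<kappa> * d"
    using \<open>d \<noteq> 0\<close> d(2) by (simp add: pos_divide_less_eq)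
  also have "\<dots> \<le> \<kappa> * norm a" using pos d by (intro mult_left_mono) auto
  finally show False using n norm_ge_zero[of x] by linarith
qed

section \<open>The perturbation estimate\<close>

theorem theorem4p1:
  fixes f0 :: "real ^ 'n \<Rightarrow> real"
    and x0 :: "real ^ 'n"
    and E0 E :: "(real ^ 'n) set"
    and \<alpha>0 \<alpha> \<kappa> \<rho> :: real
  assumes "f0 \<in> Gam"
    and "bounded (levelset f0)"
    and "x0 \<in> levelset f0"
    and "\<alpha>0 > 0"
    and "E0 = levelset f0 + cball 0 \<alpha>0"
    and "ereal \<kappa> > kappa0 (Uset f0 E0) x0"
    and "\<alpha> > 0"
    and "E = E0 + cball 0 \<alpha>"
    and "\<rho> = rho_of E"
  shows "\<exists>\<delta>0>0. \<forall>\<delta>. 0 < \<delta> \<and> \<delta> \<le> \<delta>0 \<longrightarrow>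
    (\<forall>f1\<in>Gam. \<forall>f2\<in>Gam. \<forall>x1\<in>levelset f1.
      esupdist E f1 f0 \<le> ereal \<delta> \<and> esupdist E f2 f0 \<le> ereal \<delta> \<and> norm (x1 - x0) \<le> \<delta> \<longrightarrow>
      edist_pt x1 (levelset f2)
        \<le> ereal \<kappa> * (ereal \<rho> * ehausdorff (subdiff_on f1 (E0 + cball 0 (sqrt \<delta>)))
                                        (subdiff_on f2 (E0 + cball 0 (sqrt \<delta>)))
                     + esupdist E f1 f2))"
proof -
  have "0 < ereal \<kappa>" by (rule le_less_trans[OF kappa0_nonneg assms(6)])
  then have \<kappa>: "\<kappa> > 0" by simp
  have x0_E0: "x0 \<in> E0"
    using set_plus_intro[OF assms(3), of 0 "cball 0 \<alpha>0"] assms(4,5) by simp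
  have ball_E: "cball x0 \<alpha> \<subseteq> E"
  proof
    fix w assume "w \<in> cball x0 \<alpha>"
    then have "w - x0 \<in> cball 0 \<alpha>" by (simp add: dist_norm norm_minus_commute)
    from set_plus_intro[OF x0_E0 this] show "w \<in> E" using assms(8) by simp
  qed
  have "bounded E"
    using assms(2,5,8) by (simp add: set_plus_image bounded_plus)
  have "0 \<le> \<rho>"
  proof -
    obtain B where B: "\<And>x. x \<in> E \<Longrightarrow> norm x \<le> B"
      using \<open>bounded E\<close> unfolding bounded_iff by blast
    have "1 + norm x0 \<le> rho_of E"
      unfolding rho_of_def
      by (rule cSUP_upper) (use ball_E \<open>\<alpha> > 0\<close> B in \<open>auto intro!: bdd_aboveI2[of _ _ "1 + B"]\<close>)
    then show ?thesis using assms(9) norm_ge_zero[of x0] by linarith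
  qed
  have "x0 \<in> interior E"
    using ball_E \<open>\<alpha> > 0\<close> by (auto simp: mem_interior_cball)
  moreover have "convex_on UNIV f0" "f0 x0 \<le> 0"
    using assms(1,3) by (auto simp: Gam_def levelset_def)
  moreover have "\<kappa> * norm a > 1" if "f0 x0 = 0" "a \<in> subdiff f0 x0" for a
    using subgradient_norm_gt that x0_E0 assms(6) by blast
  ultimately obtain \<delta>1 where \<delta>1: "\<delta>1 > 0"
    and bound: "\<And>\<delta> f x. \<lbrakk>\<delta> \<le> \<delta>1; convex_on UNIV f; \<And>w. w \<in> E \<Longrightarrow> \<bar>f w - f0 w\<bar> \<le> \<delta>;
        norm (x - x0) \<le> \<delta>; 0 < f x; f x \<le> 2 * \<delta>\<rbrakk>
      \<Longrightarrow> \<exists>y. f y \<le> 0 \<and> norm (y - x) \<le> \<kappa> * f x"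
    using uniform_error_bound[of f0 x0 E \<kappa>] \<kappa> by metis
  \<comment> \<open>The bound by \<open>\<alpha>\<close> keeps \<open>x1\<close> in \<open>E\<close>, where the functions are compared.\<close>
  show ?thesis
  proof (intro exI[of _ "min \<delta>1 \<alpha>"] conjI allI impI ballI; (elim conjE)?)
    show "0 < min \<delta>1 \<alpha>" using \<delta>1 \<open>\<alpha> > 0\<close> by simp
  next
    fix \<delta> f1 f2 x1
    assume \<delta>: "0 < \<delta>" "\<delta> \<le> min \<delta>1 \<alpha>" and f: "f1 \<in> Gam" "f2 \<in> Gam" and x1: "x1 \<in> levelset f1"
      and d: "esupdist E f1 f0 \<le> ereal \<delta>" "esupdist E f2 f0 \<le> ereal \<delta>" "norm (x1 - x0) \<le> \<delta>"
    define D where "D = ehausdorff (subdiff_on f1 (E0 + cball 0 (sqrt \<delta>)))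
                                   (subdiff_on f2 (E0 + cball 0 (sqrt \<delta>)))"
    have x1E: "x1 \<in> E"
      using ball_E d(3) \<delta>(2) by (auto simp: subset_iff dist_norm norm_minus_commute)
    have near: "\<bar>f1 w - f0 w\<bar> \<le> \<delta>" "\<bar>f2 w - f0 w\<bar> \<le> \<delta>" if "w \<in> E" for w
      using order_trans[OF abs_le_esupdist[OF that] d(1)]
        order_trans[OF abs_le_esupdist[OF that] d(2)] by auto
    have "x0 \<in> E0 + cball 0 (sqrt \<delta>)"
      using set_plus_intro[OF x0_E0, of 0 "cball 0 (sqrt \<delta>)"] \<delta>(1) by simp
    then have "subdiff_on f1 (E0 + cball 0 (sqrt \<delta>)) \<noteq> {}"
      using subdiff_nonempty[of f1 x0] f(1) unfolding subdiff_on_def Gam_def by blast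
    then have "0 \<le> D" unfolding D_def by (rule ehausdorff_nonneg)
    then have "0 \<le> ereal \<rho> * D" using \<open>0 \<le> \<rho>\<close> by simp
    have "f1 x1 \<le> 0" using x1 by (simp add: levelset_def)
    have "\<exists>y. f2 y \<le> 0 \<and> norm (y - x1) \<le> \<kappa> * \<bar>f1 x1 - f2 x1\<bar>"
    proof (cases "f2 x1 > 0")
      case True
      have "f2 x1 \<le> 2 * \<delta>" using near[OF x1E] \<open>f1 x1 \<le> 0\<close> by linarith
      then obtain y where "f2 y \<le> 0" "norm (y - x1) \<le> \<kappa> * f2 x1"
        using bound[of \<delta> f2 x1] \<delta> f(2) near(2) d(3) True by (auto simp: Gam_def)
      moreover have "\<kappa> * f2 x1 \<le> \<kappa> * \<bar>f1 x1 - f2 x1\<bar>"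
        using \<kappa> \<open>f1 x1 \<le> 0\<close> by (intro mult_left_mono) auto
      ultimately show ?thesis by force
    qed (use \<kappa> in \<open>auto intro!: exI[of _ x1]\<close>)
    then obtain y where y: "f2 y \<le> 0" "norm (y - x1) \<le> \<kappa> * \<bar>f1 x1 - f2 x1\<bar>" by blast
    have "edist_pt x1 (levelset f2) \<le> ereal (norm (x1 - y))"
      unfolding edist_pt_def by (rule INF_lower) (use y in \<open>simp add: levelset_def\<close>)
    also have "\<dots> \<le> ereal \<kappa> * ereal \<bar>f1 x1 - f2 x1\<bar>"
      using y(2) by (simp add: norm_minus_commute)
    also have "\<dots> \<le> ereal \<kappa> * (ereal \<rho> * D + esupdist E f1 f2)"
    proof (rule ereal_mult_left_mono)
      show "ereal \<bar>f1 x1 - f2 x1\<bar> \<le> ereal \<rho> * D + esupdist E f1 f2"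
        using add_mono[OF \<open>0 \<le> ereal \<rho> * D\<close> abs_le_esupdist[OF x1E, of f1 f2]] by simp
    qed (use \<kappa> in simp)
    finally show "edist_pt x1 (levelset f2) \<le> ereal \<kappa> *
        (ereal \<rho> * ehausdorff (subdiff_on f1 (E0 + cball 0 (sqrt \<delta>)))
                              (subdiff_on f2 (E0 + cball 0 (sqrt \<delta>)))
         + esupdist E f1 f2)"
      unfolding D_def .
  qed
qed

end
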